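(* Let $T$ be a rooted tree as in the context and $p\in(1,\infty)$. Every function $g\in W^{1,p}(T)$ has boundary values $c_p$-almost everywhere on $\partial T$; that is, $c_p(\partial T\setminus\mathcal{F}(g))=0$, where $\mathcal{F}(g)$ is the Fatou set of $g$.
   Context: Tree: $T$ is a locally finite tree (connected graph without cycles, every vertex having finitely many neighbours) with vertex set $V(T)$, edge set $E(T)$ and a distinguished root edge $\omega$. One endpoint $o=b(\omega)$ of $\omega$ is an endpoint of no other edge, and every vertex other than $o$ is an endpoint of at least two edges (no leaves). For an edge $\alpha$, $b(\alpha)$ is its endpoint nearer to $o$ and $e(\alpha)$ the other endpoint. The boundary $\partial T$ is the set of infinite geodesics (infinite edge paths without backtracking) starting with $\omega$, with topology generated by the sets $\partial T_\alpha$ of geodesics through $\alpha$. For $\zeta\in\partial T$, $\alpha<\zeta$ means that the edge $\alpha$ belongs to $\zeta$. Fatou set: for $g:V(T)\to\mathbb{R}$ and $\zeta\in\partial T$ with successive vertices $x_0=o,x_1,x_2,\dots$, the radial limit is $\lim_{x\to\zeta}g(x)=\lim_{j\to\infty}g(x_j)$; $\mathcal{F}(g)$ is the set of $\zeta\in\partial T$ for which this limit exists in $\mathbb{R}\cup\{\pm\infty\}$. Gradient and Sobolev space: $\nabla g(\alpha)=g(e(\alpha))-g(b(\alpha))$, and $W^{1,p}(T)=\{g:V(T)\to\mathbb{R}:\ \nabla g\in\ell^p(E(T))\}$. Capacity: for Borel $E\subseteq\partial T$, $c_p(E)=\inf\{\sum_{\alpha\in E(T)}f(\alpha)^p:\ f:E(T)\to[0,\infty),\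 \sum_{\alpha<\zeta}f(\alpha)\ge1\ \text{for all }\zeta\in E\}$. A property holds $c_p$-almost everywhere if the exceptional set has $p$-capacity zero. *)

theory Defs
  imports "HOL-Analysis.Analysis"
begin

text \<open>Graphs are simple and undirected: a vertex set \<open>V\<close> and a set \<open>E\<close> of two-element subsets of \<open>V\<close>.\<close>

definition walk :: "'a set set \<Rightarrow> 'a list \<Rightarrow> bool" where
  "walk E xs \<longleftrightarrow> xs \<noteq> [] \<and> (\<forall>i. Suc i < length xs \<longrightarrow> {xs ! i, xs ! Suc i} \<in> E)"

definition cycle :: "'a set set \<Rightarrow> 'a list \<Rightarrow> bool" where
  "cycle E xs \<longleftrightarrow> walk E xs \<and> 3 \<le> length xs \<and> distinct xs \<and> {last xs, hd xs} \<in> E"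

definition graph_dist :: "'a set set \<Rightarrow> 'a \<Rightarrow> 'a \<Rightarrow> nat" where
  "graph_dist E x y = (LEAST n. \<exists>xs. walk E xs \<and> hd xs = x \<and> last xs = y \<and> length xs = Suc n)"

locale rooted_tree =
  fixes V :: "'a set" and E :: "'a set set" and r :: 'a and \<omega> :: "'a set"
  assumes edge: "\<alpha> \<in> E \<Longrightarrow> \<alpha> \<subseteq> V \<and> card \<alpha> = 2"
    and connected: "x \<in> V \<Longrightarrow> y \<in> V \<Longrightarrow> \<exists>xs. walk E xs \<and> hd xs = x \<and> last xs = y"
    and acyclic: "\<not> cycle E xs"
    and locally_finite: "x \<in> V \<Longrightarrow> finite {\<alpha> \<in> E. x \<in> \<alpha>}"
    and root_edges: "{\<alpha> \<in> E. r \<in> \<alpha>} = {\<omega>}"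
    and no_leaves: "x \<in> V \<Longrightarrow> x \<noteq> r \<Longrightarrow> 2 \<le> card {\<alpha> \<in> E. x \<in> \<alpha>}"

text \<open>The endpoint of \<open>\<alpha>\<close> nearer to the root, and the other endpoint. The two endpoints of an edge of
  a tree are never equidistant from the root.\<close>

definition edge_begin :: "'a set set \<Rightarrow> 'a \<Rightarrow> 'a set \<Rightarrow> 'a" where
  "edge_begin E r \<alpha> = arg_min_on (graph_dist E r) \<alpha>"

definition edge_end :: "'a set set \<Rightarrow> 'a \<Rightarrow> 'a set \<Rightarrow> 'a" where
  "edge_end E r \<alpha> = (THE y. y \<in> \<alpha> \<and> y \<noteq> edge_begin E r \<alpha>)"

text \<open>An infinite geodesic is encoded by the sequence of its successive vertices.\<close>

definition tree_boundary :: "'a set set \<Rightarrow> 'a \<Rightarrow> 'a set \<Rightarrow> (nat \<Rightarrow> 'a) set" where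
  "tree_boundary E r \<omega> = {\<zeta>. \<zeta> 0 = r \<and> {\<zeta> 0, \<zeta> 1} = \<omega> \<and>
     (\<forall>j. {\<zeta> j, \<zeta> (Suc j)} \<in> E) \<and> (\<forall>j. \<zeta> (Suc (Suc j)) \<noteq> \<zeta> j)}"

definition path_edges :: "(nat \<Rightarrow> 'a) \<Rightarrow> 'a set set" where
  "path_edges \<zeta> = range (\<lambda>j. {\<zeta> j, \<zeta> (Suc j)})"

definition boundary_topology :: "'a set set \<Rightarrow> 'a \<Rightarrow> 'a set \<Rightarrow> (nat \<Rightarrow> 'a) topology" where
  "boundary_topology E r \<omega> =
     topology_generated_by ((\<lambda>\<alpha>. {\<zeta> \<in> tree_boundary E r \<omega>. \<alpha> \<in> path_edges \<zeta>}) ` E)"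

definition boundary_borel :: "'a set set \<Rightarrow> 'a \<Rightarrow> 'a set \<Rightarrow> (nat \<Rightarrow> 'a) measure" where
  "boundary_borel E r \<omega> =
     sigma (tree_boundary E r \<omega>) {U. openin (boundary_topology E r \<omega>) U}"

definition fatou_set :: "'a set set \<Rightarrow> 'a \<Rightarrow> 'a set \<Rightarrow> ('a \<Rightarrow> real) \<Rightarrow> (nat \<Rightarrow> 'a) set" where
  "fatou_set E r \<omega> g =
     {\<zeta> \<in> tree_boundary E r \<omega>. \<exists>L::ereal. (\<lambda>j. ereal (g (\<zeta> j))) \<longlonglongrightarrow> L}"

definition gradient :: "'a set set \<Rightarrow> 'a \<Rightarrow> ('a \<Rightarrow> real) \<Rightarrow> 'a set \<Rightarrow> real" where
  "gradient E r g \<alpha> = g (edge_end E r \<alpha>) - g (edge_begin E r \<alpha>)"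

definition sobolev :: "'a set set \<Rightarrow> 'a \<Rightarrow> real \<Rightarrow> ('a \<Rightarrow> real) set" where
  "sobolev E r p = {g. (\<lambda>\<alpha>. \<bar>gradient E r g \<alpha>\<bar> powr p) summable_on E}"

text \<open>The infimum makes sense for every set \<open>A\<close> of geodesics; it is the \<open>p\<close>-capacity when \<open>A\<close> is a Borel
  set of the boundary. Both sums have nonnegative terms and are taken in \<open>[0, \<infinity>]\<close>.\<close>

definition capacity :: "'a set set \<Rightarrow> real \<Rightarrow> (nat \<Rightarrow> 'a) set \<Rightarrow> ennreal" where
  "capacity E p A =
     (INF f \<in> {f :: 'a set \<Rightarrow> real. (\<forall>\<alpha>\<in>E. 0 \<le> f \<alpha>) \<and>
                 (\<forall>\<zeta>\<in>A. 1 \<le> (\<Sum>\<^sub>\<infinity>\<alpha>\<in>path_edges \<zeta>. ennreal (f \<alpha>)))}.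
        (\<Sum>\<^sub>\<infinity>\<alpha>\<in>E. ennreal (f \<alpha> powr p)))"

text \<open>The exceptional set of a function on the vertices is Borel, so its capacity is the one of a
  Borel set.\<close>

context rooted_tree
begin

lemma nonbacktracking_inj:
  assumes e: "\<And>j. {x j, x (Suc j)} \<in> E" and nb: "\<And>j. x (Suc (Suc j)) \<noteq> x j"
  shows "inj x"
proof (rule ccontr)
  assume "\<not> inj x"
  then obtain a b where "a < b" "x a = x b"
    by (metis injI linorder_neqE_nat)
  then have ex: "\<exists>d>0. \<exists>i. x i = x (i + d)"
    by (metis less_imp_add_positive)
  define d where "d = (LEAST d. d > 0 \<and> (\<exists>i. x i = x (i + d)))"
  have d: "d > 0 \<and> (\<exists>i. x i = x (i + d))"
    unfolding d_def by (rule LeastI_ex) (use ex in blast)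
  have least: "\<not> (d' > 0 \<and> (\<exists>i. x i = x (i + d')))" if "d' < d" for d'
    using that unfolding d_def by (rule not_less_Least)
  from d obtain i where i: "x i = x (i + d)" and "d > 0" by blast
  have "d \<noteq> 1"
  proof
    assume "d = 1"
    then show False using edge[OF e[of i]] i by simp
  qed
  moreover have "d \<noteq> 2" using nb[of i] i by auto
  ultimately have d3: "d \<ge> 3" using \<open>d > 0\<close> by linarith
  define xs where "xs = map x [i..<i+d]"
  have dist: "x k \<noteq> x l" if "i \<le> k" "k < l" "l < i + d" for k l
  proof
    assume "x k = x l"
    then have "x k = x (k + (l - k))" using that by simp
    moreover have "l - k < d" "0 < l - k" using that by linarith+
    ultimately show False using least[of "l - k"] by blast
  qed
  have "distinct xs"
    unfolding xs_def distinct_map inj_on_def using dist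
    by (auto) (metis linorder_neqE_nat)
  moreover have "walk E xs"
    unfolding walk_def xs_def using e d3 by auto
  moreover have "{last xs, hd xs} \<in> E"
  proof -
    have "last xs = x (i + d - 1)" "hd xs = x (i + d)"
      using d3 i by (auto simp: xs_def last_map hd_map)
    then show ?thesis using e[of "i + d - 1"] d3 by simp
  qed
  moreover have "3 \<le> length xs" using d3 by (simp add: xs_def)
  ultimately show False using acyclic[of xs] unfolding cycle_def by blast
qed

lemma boundary_vertex_index:
  assumes z: "\<zeta> \<in> tree_boundary E r \<omega>" and h: "\<eta> \<in> tree_boundary E r \<omega>"
    and eq: "\<zeta> i = \<eta> k"
  shows "i = k"
proof (rule ccontr)
  assume "i \<noteq> k"
  have ez: "\<And>j. {\<zeta> j, \<zeta> (Suc j)} \<in> E" "\<And>j. \<zeta> (Suc (Suc j)) \<noteq> \<zeta> j" "\<zeta> 0 = r"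
    and eh: "\<And>j. {\<eta> j, \<eta> (Suc j)} \<in> E" "\<And>j. \<eta> (Suc (Suc j)) \<noteq> \<eta> j" "\<eta> 0 = r"
    using z h by (auto simp: tree_boundary_def)
  have iz: "inj \<zeta>" by (rule nonbacktracking_inj) (use ez in auto)
  have ih: "inj \<eta>" by (rule nonbacktracking_inj) (use eh in auto)
  have "\<zeta> i \<noteq> \<eta> i" "\<zeta> k \<noteq> \<eta> k"
    using eq \<open>i \<noteq> k\<close> iz ih by (metis injD)+
  define m where "m = (LEAST j. \<zeta> (Suc j) \<noteq> \<eta> (Suc j))"
  have "\<exists>j. \<zeta> (Suc j) \<noteq> \<eta> (Suc j)"
    using \<open>\<zeta> i \<noteq> \<eta> i\<close> ez(3) eh(3) by (cases i) auto
  then have m: "\<zeta> (Suc m) \<noteq> \<eta> (Suc m)" unfolding m_def by (rule LeastI_ex)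
  have le: "\<zeta> j = \<eta> j" if "j \<le> m" for j
  proof (cases j)
    case 0 then show ?thesis using ez(3) eh(3) by simp
  next
    case (Suc j')
    then have "j' < m" using that by simp
    then show ?thesis using not_less_Least[of j' "\<lambda>j. \<zeta> (Suc j) \<noteq> \<eta> (Suc j)"] Suc
      by (auto simp: m_def)
  qed
  have im: "m < i" "m < k"
    using le \<open>\<zeta> i \<noteq> \<eta> i\<close> \<open>\<zeta> k \<noteq> \<eta> k\<close> by (meson not_le_imp_less)+
  define n where "n = i - m"
  define w where "w = (\<lambda>t. if t \<le> n then \<zeta> (i - t) else \<eta> (m + (t - n)))"
  have "inj w"
  proof (rule nonbacktracking_inj)
    fix j
    show "{w j, w (Suc j)} \<in> E"
    proof (cases "j < n")
      case True
      then have "w j = \<zeta> (Suc (i - Suc j))" "w (Suc j) = \<zeta> (i - Suc j)"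
        using im by (auto simp: w_def n_def intro!: arg_cong[where f=\<zeta>])
      then show ?thesis using ez(1)[of "i - Suc j"] by (simp add: insert_commute)
    next
      case False
      then have "w j = \<eta> (m + (j - n))" "w (Suc j) = \<eta> (Suc (m + (j - n)))"
        using im le[of m] by (auto simp: w_def n_def Suc_diff_le)
      then show ?thesis using eh(1) by simp
    qed
    show "w (Suc (Suc j)) \<noteq> w j"
    proof (cases "Suc (Suc j) \<le> n")
      case True
      then have "w j = \<zeta> (Suc (Suc (i - Suc (Suc j))))" "w (Suc (Suc j)) = \<zeta> (i - Suc (Suc j))"
        using im by (auto simp: w_def n_def intro!: arg_cong[where f=\<zeta>])
      then show ?thesis using ez(2)[of "i - Suc (Suc j)"] by simp
    next
      case False
      show ?thesis
      proof (cases "Suc j = n")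
        case True
        then have "w j = \<zeta> (Suc m)" "w (Suc (Suc j)) = \<eta> (Suc m)"
          using im by (auto simp: w_def n_def intro!: arg_cong[where f=\<zeta>] arg_cong[where f=\<eta>])
        then show ?thesis using m by simp
      next
        case False
        with \<open>\<not> Suc (Suc j) \<le> n\<close> have "n \<le> j" by simp
        then have "w j = \<eta> (m + (j - n))" "w (Suc (Suc j)) = \<eta> (Suc (Suc (m + (j - n))))"
          using im le[of m] by (auto simp: w_def n_def Suc_diff_le)
        then show ?thesis using eh(2) by simp
      qed
    qed
  qed
  moreover have "w 0 = w (n + (k - m))"
    using im eq by (auto simp: w_def)
  ultimately show False using im by (auto dest!: injD)
qed

lemma openin_boundary_vertex:
  "openin (boundary_topology E r \<omega>) {\<zeta> \<in> tree_boundary E r \<omega>. \<zeta> j \<in> S}"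
proof (subst openin_subopen, intro ballI)
  fix \<zeta> assume z: "\<zeta> \<in> {\<zeta> \<in> tree_boundary E r \<omega>. \<zeta> j \<in> S}"
  define \<alpha> where "\<alpha> = {\<zeta> j, \<zeta> (Suc j)}"
  have "\<alpha> \<in> E" using z by (auto simp: tree_boundary_def \<alpha>_def)
  let ?U = "{\<eta> \<in> tree_boundary E r \<omega>. \<alpha> \<in> path_edges \<eta>}"
  have "openin (boundary_topology E r \<omega>) ?U"
    unfolding boundary_topology_def by (rule topology_generated_by_Basis) (use \<open>\<alpha> \<in> E\<close> in blast)
  moreover have "\<zeta> \<in> ?U" using z by (auto simp: path_edges_def \<alpha>_def)
  moreover have "?U \<subseteq> {\<zeta> \<in> tree_boundary E r \<omega>. \<zeta> j \<in> S}"
  proof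
    fix \<eta> assume h: "\<eta> \<in> ?U"
    then obtain k where "{\<zeta> j, \<zeta> (Suc j)} = {\<eta> k, \<eta> (Suc k)}"
      by (auto simp: path_edges_def \<alpha>_def)
    then obtain l where l: "\<zeta> j = \<eta> l" by (metis doubleton_eq_iff)
    then have "j = l" using boundary_vertex_index z h by blast
    then show "\<eta> \<in> {\<zeta> \<in> tree_boundary E r \<omega>. \<zeta> j \<in> S}" using z h l by auto
  qed
  ultimately show "\<exists>T. openin (boundary_topology E r \<omega>) T \<and> \<zeta> \<in> T \<and>
      T \<subseteq> {\<zeta> \<in> tree_boundary E r \<omega>. \<zeta> j \<in> S}" by blast
qed

lemma topspace_boundary_topology: "topspace (boundary_topology E r \<omega>) = tree_boundary E r \<omega>"
proof
  show "topspace (boundary_topology E r \<omega>) \<subseteq> tree_boundary E r \<omega>"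
    by (auto simp: boundary_topology_def)
  show "tree_boundary E r \<omega> \<subseteq> topspace (boundary_topology E r \<omega>)"
    using openin_subset[OF openin_boundary_vertex[of 0 UNIV]] by simp
qed

lemma exceptional_set_borel:
  "tree_boundary E r \<omega> - fatou_set E r \<omega> g \<in> sets (boundary_borel E r \<omega>)"
proof -
  let ?B = "tree_boundary E r \<omega>" and ?M = "boundary_borel E r \<omega>"
  have sub: "{U. openin (boundary_topology E r \<omega>) U} \<subseteq> Pow ?B"
    using openin_subset topspace_boundary_topology by blast
  have space: "space ?M = ?B"
    by (simp add: boundary_borel_def space_measure_of[OF sub])
  have open_sets: "U \<in> sets ?M" if "openin (boundary_topology E r \<omega>) U" for U
    using that by (simp add: boundary_borel_def sets_measure_of[OF sub] sigma_sets.Basic)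
  have [measurable]: "(\<lambda>\<zeta>. ereal (g (\<zeta> j))) \<in> borel_measurable ?M" for j
  proof (rule measurableI)
    fix A :: "ereal set"
    have "(\<lambda>\<zeta>. ereal (g (\<zeta> j))) -` A \<inter> space ?M = {\<zeta> \<in> ?B. \<zeta> j \<in> {v. ereal (g v) \<in> A}}"
      by (auto simp: space)
    then show "(\<lambda>\<zeta>. ereal (g (\<zeta> j))) -` A \<inter> space ?M \<in> sets ?M"
      by (simp only: open_sets[OF openin_boundary_vertex])
  qed simp
  have conv: "(\<exists>L. X \<longlonglongrightarrow> L) \<longleftrightarrow> liminf X = limsup X" for X :: "nat \<Rightarrow> ereal"
    by (metis Liminf_eq_Limsup lim_imp_Liminf lim_imp_Limsup trivial_limit_sequentially)
  have "?B - fatou_set E r \<omega> g =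
      space ?M - {\<zeta> \<in> space ?M. liminf (\<lambda>j. ereal (g (\<zeta> j))) = limsup (\<lambda>j. ereal (g (\<zeta> j)))}"
    by (auto simp: space fatou_set_def conv)
  also have "\<dots> \<in> sets ?M" by measurable
  finally show ?thesis .
qed

end

end

theory Submission
  imports Defs
begin

text \<open>Along a geodesic on which \<open>\<bar>\<nabla>g\<bar>\<close> has a finite sum, \<open>g\<close> has bounded variation and thus converges.
  So \<open>\<bar>\<nabla>g\<bar>\<close> has an infinite sum along every exceptional geodesic, and \<open>\<epsilon> \<bar>\<nabla>g\<bar>\<close> is admissible for the
  capacity of the exceptional set for every \<open>\<epsilon> > 0\<close>. Its energy is \<open>\<epsilon>\<^sup>p\<close> times the finite \<open>p\<close>-energy
  of \<open>\<nabla>g\<close>, which tends to \<open>0\<close> with \<open>\<epsilon>\<close>.\<close>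

lemma convergent_if_bounded_variation:
  fixes X :: "nat \<Rightarrow> real"
  assumes "\<And>n. (\<Sum>j<n. \<bar>X (Suc j) - X j\<bar>) \<le> B"
  shows "convergent X"
proof -
  have "summable (\<lambda>j. \<bar>X (Suc j) - X j\<bar>)"
    by (rule summableI_nonneg_bounded[where x = B]) (use assms in auto)
  then have "summable (\<lambda>j. X (Suc j) - X j)"
    by (rule summable_rabs_cancel)
  then have "convergent (\<lambda>n. X n - X 0)"
    by (simp add: summable_iff_convergent sum_lessThan_telescope)
  then show ?thesis
    by (simp add: convergent_diff_const_right_iff)
qed

text \<open>\<open>edge_begin\<close> picks one of the two endpoints, and swapping them only flips
  the sign of the gradient. Hence the variation of \<open>g\<close> along a geodesic can be computed
  without knowing which endpoint is nearer to the root.\<close>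

lemma abs_gradient_edge:
  assumes "x \<noteq> y"
  shows "\<bar>gradient E r g {x, y}\<bar> = \<bar>g y - g x\<bar>"
proof -
  have "edge_begin E r {x, y} \<in> {x, y}"
    unfolding edge_begin_def by (rule arg_min_if_finite) auto
  then consider "edge_begin E r {x, y} = x" | "edge_begin E r {x, y} = y"
    by blast
  then show ?thesis
  proof cases
    case 1
    then have "edge_end E r {x, y} = y"
      unfolding edge_end_def using assms by (intro the_equality) auto
    with 1 show ?thesis by (simp add: gradient_def)
  next
    case 2
    then have "edge_end E r {x, y} = x"
      unfolding edge_end_def using assms by (intro the_equality) auto
    with 2 show ?thesis by (simp add: gradient_def abs_minus_commute)
  qed
qed

context rooted_tree
begin

lemma boundary_inj:
  assumes "\<zeta> \<in> tree_boundary E r \<omega>"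
  shows "inj \<zeta>"
  using assms by (intro nonbacktracking_inj) (auto simp: tree_boundary_def)

text \<open>Lets sums over the set \<open>path_edges \<zeta>\<close> be reindexed by the steps of
  \<zeta>, each edge being counted once.\<close>

lemma boundary_edge_inj:
  assumes "\<zeta> \<in> tree_boundary E r \<omega>"
  shows "inj (\<lambda>j. {\<zeta> j, \<zeta> (Suc j)})"
proof (rule injI)
  fix i j assume "{\<zeta> i, \<zeta> (Suc i)} = {\<zeta> j, \<zeta> (Suc j)}"
  then show "i = j"
    using boundary_inj[OF assms] by (auto simp: doubleton_eq_iff inj_eq)
qed

lemma scaled_gradient_admissible:
  assumes z: "\<zeta> \<in> tree_boundary E r \<omega> - fatou_set E r \<omega> g" and "0 < \<epsilon>"
  shows "1 \<le> (\<Sum>\<^sub>\<infinity>\<alpha>\<in>path_edges \<zeta>. ennreal (\<epsilon> * \<bar>gradient E r g \<alpha>\<bar>))"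
proof (rule ccontr)
  let ?f = "\<lambda>\<alpha>. ennreal (\<epsilon> * \<bar>gradient E r g \<alpha>\<bar>)" and ?e = "\<lambda>j. {\<zeta> j, \<zeta> (Suc j)}"
  assume "\<not> ?thesis"
  then have less: "infsum ?f (path_edges \<zeta>) \<le> 1" by simp
  have inj: "inj \<zeta>" "inj ?e"
    using z boundary_inj boundary_edge_inj by blast+
  \<comment> \<open>A sum of at most 1 for the function scaled by \<epsilon> leaves at most
    \<open>1 / \<epsilon>\<close> for the variation of \<open>g\<close> along \<zeta>.\<close>
  have "(\<Sum>j<n. \<bar>g (\<zeta> (Suc j)) - g (\<zeta> j)\<bar>) \<le> 1 / \<epsilon>" for n
  proof -
    have "ennreal (\<epsilon> * (\<Sum>j<n. \<bar>g (\<zeta> (Suc j)) - g (\<zeta> j)\<bar>)) = (\<Sum>j<n. ?f (?e j))"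
      using \<open>0 < \<epsilon>\<close> inj(1) by (simp add: abs_gradient_edge inj_eq sum_distrib_left sum_ennreal)
    also have "\<dots> = sum ?f (?e ` {..<n})"
      by (simp add: sum.reindex[OF inj_on_subset[OF inj(2)]])
    \<comment> \<open>In \<open>ennreal\<close> the infinite sum is the supremum of the sums over
      finite subsets.\<close>
    also have "\<dots> \<le> infsum ?f (path_edges \<zeta>)"
      by (subst nonneg_infsum_complete) (auto simp: path_edges_def intro!: SUP_upper)
    finally have "ennreal (\<epsilon> * (\<Sum>j<n. \<bar>g (\<zeta> (Suc j)) - g (\<zeta> j)\<bar>)) \<le> 1"
      using less by (rule order_trans)
    then show ?thesis
      using \<open>0 < \<epsilon>\<close> by (simp add: field_simps)
  qed
  then have "convergent (\<lambda>j. g (\<zeta> j))"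
    by (rule convergent_if_bounded_variation)
  then obtain L where "(\<lambda>j. g (\<zeta> j)) \<longlonglongrightarrow> L"
    by (auto simp: convergent_def)
  then have "(\<lambda>j. ereal (g (\<zeta> j))) \<longlonglongrightarrow> ereal L"
    by simp
  with z show False by (auto simp: fatou_set_def)
qed

lemma capacity_exceptional_set_le:
  assumes g: "g \<in> sobolev E r p" and "0 < \<epsilon>"
  shows "capacity E p (tree_boundary E r \<omega> - fatou_set E r \<omega> g)
    \<le> ennreal (\<epsilon> powr p * (\<Sum>\<^sub>\<infinity>\<alpha>\<in>E. \<bar>gradient E r g \<alpha>\<bar> powr p))"
proof -
  let ?h = "\<lambda>\<alpha>. \<epsilon> powr p * \<bar>gradient E r g \<alpha>\<bar> powr p"
  have sm: "?h summable_on E"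
    using g by (intro summable_on_cmult_right) (simp add: sobolev_def)
  have "capacity E p (tree_boundary E r \<omega> - fatou_set E r \<omega> g)
    \<le> (\<Sum>\<^sub>\<infinity>\<alpha>\<in>E. ennreal ((\<epsilon> * \<bar>gradient E r g \<alpha>\<bar>) powr p))"
    unfolding capacity_def
    by (rule INF_lower) (use scaled_gradient_admissible \<open>0 < \<epsilon>\<close> in auto)
  also have "\<dots> = (\<Sum>\<^sub>\<infinity>\<alpha>\<in>E. ennreal (?h \<alpha>))"
    using \<open>0 < \<epsilon>\<close> by (simp add: powr_mult)
  \<comment> \<open>Summability is essential here: a real \<open>infsum\<close> defaults to 0 for a
    family that is not summable.\<close>
  also have "\<dots> = ennreal (\<Sum>\<^sub>\<infinity>\<alpha>\<in>E. ?h \<alpha>)"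
    using infsum_comm_additive_general[of E ennreal ?h] sm by (simp add: o_def sum_ennreal)
  also have "\<dots> = ennreal (\<epsilon> powr p * (\<Sum>\<^sub>\<infinity>\<alpha>\<in>E. \<bar>gradient E r g \<alpha>\<bar> powr p))"
    by (simp add: infsum_cmult_right')
  finally show ?thesis .
qed

end

theorem proposition4p8:
  fixes V :: "'a set" and E :: "'a set set" and r :: 'a and \<omega> :: "'a set"
    and p :: real and g :: "'a \<Rightarrow> real"
  assumes "rooted_tree V E r \<omega>"
    and "1 < p"
    and "g \<in> sobolev E r p"
  shows "capacity E p (tree_boundary E r \<omega> - fatou_set E r \<omega> g) = 0"
proof -
  interpret rooted_tree V E r \<omega> by fact
  let ?S = "\<Sum>\<^sub>\<infinity>\<alpha>\<in>E. \<bar>gradient E r g \<alpha>\<bar> powr p"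
  let ?c = "capacity E p (tree_boundary E r \<omega> - fatou_set E r \<omega> g)"
  \<comment> \<open>At base 0, continuity of \<open>powr\<close> requires a positive exponent and
    nonnegative bases, whence the one-sided limit; the capacity bound also holds only for positive
    \<epsilon>.\<close>
  have "((\<lambda>\<epsilon>. \<epsilon> powr p * ?S) \<longlongrightarrow> 0 powr p * ?S) (at_right 0)"
    using \<open>1 < p\<close> by (intro tendsto_intros tendsto_powr') (auto simp: eventually_at_filter)
  then have "((\<lambda>\<epsilon>. ennreal (\<epsilon> powr p * ?S)) \<longlongrightarrow> ennreal 0) (at_right 0)"
    by (intro tendsto_ennrealI) simp
  moreover have "\<forall>\<^sub>F \<epsilon> in at_right 0. ?c \<le> ennreal (\<epsilon> powr p * ?S)"
    using capacity_exceptional_set_le[OF assms(3)] by (auto simp: eventually_at_filter)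
  ultimately have "?c \<le> ennreal 0"
    by (intro tendsto_lowerbound) auto
  then show ?thesis by simp
qed

end
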